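(* Let $G$ be a connected graph such that $\mathcal{C}_G$ has exactly three equivalence classes, and let $S_e$ and $S_f$ be two distinct equivalence classes of $\mathcal{C}_G$. If the sets $V(S_e)\setminus V(S_f)$, $V(S_f)\setminus V(S_e)$ and $V(S_e)\cap V(S_f)$ are all nonempty, then $G$ is complete tripartite.
   Context: A quasi-transitive $2$-edge-colouring of a graph $G$ is a map $c: E(G)\to\{R,B\}$ such that for all pairs of edges $xy, yz \in E(G)$ with $c(xy)\neq c(yz)$, we have $xz\in E(G)$. $\mathcal{C}_G$ is the equivalence relation on $E(G)$ with $e\sim f$ iff $c(e)=c(f)$ for every quasi-transitive $2$-edge-colouring $c$ of $G$. For a set of edges $E$, $V(E)$ denotes the set of endpoints of edges in $E$. *)

theory Defs
  imports Main "HOL-Library.Disjoint_Sets" "HOL-Library.Ramsey"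
begin

text \<open>A graph is a vertex set \<open>V\<close> with a set \<open>E\<close> of two-element subsets of \<open>V\<close> (no loops, no
  multiple edges). Neither set is required to be finite.\<close>

definition graph :: "'a set \<Rightarrow> 'a set set \<Rightarrow> bool" where
  "graph V E \<longleftrightarrow> E \<subseteq> [V]\<^bsup>2\<^esup>"

definition connected_graph :: "'a set \<Rightarrow> 'a set set \<Rightarrow> bool" where
  "connected_graph V E \<longleftrightarrow>
     graph V E \<and> V \<noteq> {} \<and> (\<forall>x\<in>V. \<forall>y\<in>V. (\<lambda>u v. {u, v} \<in> E)\<^sup>*\<^sup>* x y)"

datatype colour = Red | Blue

text \<open>A colouring is a total function on sets of vertices of which only the values on \<open>E\<close> matter.
  In the condition below, \<open>x \<noteq> z\<close> is automatic, since the two edges have different colours.\<close>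

definition quasi_transitive_colouring :: "'a set set \<Rightarrow> ('a set \<Rightarrow> colour) \<Rightarrow> bool" where
  "quasi_transitive_colouring E c \<longleftrightarrow>
     (\<forall>x y z. {x, y} \<in> E \<and> {y, z} \<in> E \<and> c {x, y} \<noteq> c {y, z} \<longrightarrow> {x, z} \<in> E)"

definition colour_equiv :: "'a set set \<Rightarrow> ('a set \<times> 'a set) set" where
  "colour_equiv E =
     {(e, f). e \<in> E \<and> f \<in> E \<and> (\<forall>c. quasi_transitive_colouring E c \<longrightarrow> c e = c f)}"

lemma equiv_colour_equiv: "equiv E (colour_equiv E)"
  by (rule equivI) (auto simp: colour_equiv_def refl_on_def sym_def trans_def)

definition endpoints :: "'a set set \<Rightarrow> 'a set" where
  "endpoints S = \<Union>S"

definition complete_tripartite :: "'a set \<Rightarrow> 'a set set \<Rightarrow> bool" where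
  "complete_tripartite V E \<longleftrightarrow>
     (\<exists>P. partition_on V P \<and> card P = 3 \<and>
          E = {{x, y} | x y. \<exists>X\<in>P. \<exists>Y\<in>P. X \<noteq> Y \<and> x \<in> X \<and> y \<in> Y})"

end

theory Submission
  imports Defs
begin

text \<open>The equivalence classes are the components of the relation that forces two adjacent edges
  \<open>xy\<close>, \<open>yz\<close> with \<open>xz \<notin> E\<close> to have the same colour. As for Gallai's implication classes, if the edges
  \<open>ca\<close> and \<open>ab\<close> of a triangle lie outside the class \<open>A\<close> of \<open>bc\<close>, then the pattern propagates along
  forcing steps: \<open>a\<close> forms with every edge of \<open>A\<close> a triangle of the same kind, and no edge of \<open>A\<close>
  contains \<open>a\<close>. If some triangle has its edges in three different classes, then every edge is in such
  a triangle, every vertex misses exactly one class, and the missed class defines the tripartition.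
  If there is no such triangle, take an edge \<open>xv \<in> S\<^sub>e\<close> with \<open>v \<in> V(S\<^sub>f)\<close> and \<open>x \<notin> V(S\<^sub>f)\<close>, and \<open>vb \<in> S\<^sub>f\<close>.
  Then \<open>xb \<in> S\<^sub>e\<close>, so by propagation \<open>x\<close> is joined by edges of \<open>S\<^sub>e\<close> to all of \<open>V(S\<^sub>f)\<close>, contradicting
  \<open>V(S\<^sub>f) - V(S\<^sub>e) \<noteq> {}\<close>.\<close>

section \<open>Edges, classes and forcing\<close>

lemma edge_obtain:
  assumes "graph V E" "e \<in> E" "x \<in> e"
  obtains y where "e = {x, y}" "x \<noteq> y" "x \<in> V" "y \<in> V"
proof -
  have "e \<subseteq> V" "card e = 2"
    using assms(1,2) by (auto simp: graph_def nsets_def)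
  then show thesis
    using assms(3) that by (auto simp: card_2_iff)
qed

lemma graph_no_loop: "graph V E \<Longrightarrow> {x, x} \<notin> E"
  by (auto simp: graph_def nsets_def)

lemma edge_subset_vertices: "graph V E \<Longrightarrow> e \<in> E \<Longrightarrow> e \<subseteq> V"
  by (auto simp: graph_def nsets_def)

lemma class_subset: "A \<in> E // colour_equiv E \<Longrightarrow> A \<subseteq> E"
  using equiv_colour_equiv in_quotient_imp_subset by blast

lemma class_eqI:
  assumes "A \<in> E // colour_equiv E" "B \<in> E // colour_equiv E" "e \<in> A" "e \<in> B"
  shows "A = B"
  using quotient_disj[OF equiv_colour_equiv assms(1,2)] assms(3,4) by blast

lemma edge_in_class:
  assumes "e \<in> E"
  obtains A where "A \<in> E // colour_equiv E" "e \<in> A"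
  using assms Union_quotient[OF equiv_colour_equiv[of E]] by blast

text \<open>If some quasi-transitive colouring separated the two edges, it would require
  \<open>{x, z}\<close> to be an edge.\<close>

lemma class_forced:
  assumes "A \<in> E // colour_equiv E" "{x, y} \<in> A" "{y, z} \<in> E" "{x, z} \<notin> E"
  shows "{y, z} \<in> A"
proof -
  have "{x, y} \<in> E"
    using assms(1,2) class_subset by blast
  then have "({x, y}, {y, z}) \<in> colour_equiv E"
    using assms(3,4) unfolding colour_equiv_def quasi_transitive_colouring_def by blast
  then show ?thesis
    using assms(1,2) in_quotient_imp_closed[OF equiv_colour_equiv] by metis
qed

lemma class_triangle:
  assumes "A \<in> E // colour_equiv E" "B \<in> E // colour_equiv E" "A \<noteq> B"
    and "{x, y} \<in> A" "{y, z} \<in> B"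
  shows "{x, z} \<in> E"
  using class_forced[of A E x y z] class_eqI[of A E B "{y, z}"] class_subset[of B E] assms by blast

text \<open>The colouring that is red exactly on the edges satisfying \<open>P\<close> is quasi-transitive.\<close>

lemma class_induct [consumes 3, case_names base step]:
  assumes A: "A \<in> E // colour_equiv E" and e: "e \<in> A" and f: "f \<in> A"
    and base: "P e"
    and step: "\<And>x y z. {x, y} \<in> A \<Longrightarrow> {y, z} \<in> A \<Longrightarrow> {x, z} \<notin> E \<Longrightarrow> P {x, y} \<Longrightarrow> P {y, z}"
  shows "P f"
proof -
  define c where "c g = (if g \<in> A \<and> P g then Red else Blue)" for g
  \<comment> \<open>Used for the path \<open>x\<close>, \<open>y\<close>, \<open>z\<close> and for
    its reversal, so that red passes in both directions when \<open>{x, z}\<close> is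
    missing.\<close>
  have cE: "c {y, z} = Red" if "c {x, y} = Red" "{y, z} \<in> E" "{x, z} \<notin> E" for x y z
  proof -
    have "{x, y} \<in> A" "P {x, y}"
      using that(1) by (auto simp: c_def split: if_splits)
    then show ?thesis
      using class_forced[OF A _ that(2,3)] step that(3) by (auto simp: c_def)
  qed
  have "{x, z} \<in> E" if "{x, y} \<in> E" "{y, z} \<in> E" "c {x, y} \<noteq> c {y, z}" for x y z
  proof (rule ccontr)
    assume "{x, z} \<notin> E"
    then have "c {x, y} = Red \<longleftrightarrow> c {y, z} = Red"
      using cE[of x y z] cE[of z y x] that(1,2) by (auto simp: insert_commute)
    then show False
      using that(3) colour.exhaust by metis
  qed
  then have "quasi_transitive_colouring E c"
    unfolding quasi_transitive_colouring_def by blast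
  moreover have "(e, f) \<in> colour_equiv E"
    using A e f quotient_eq_iff[OF equiv_colour_equiv A A e f] by simp
  ultimately have "c e = c f"
    by (auto simp: colour_equiv_def)
  then show ?thesis
    using e base by (auto simp: c_def split: if_splits)
qed

section \<open>Propagation of triangles along a class\<close>

text \<open>Induction along the forcing steps inside \<open>A\<close>. The case \<open>B = C\<close>
  is deliberately allowed, so triangles with edges in only two classes propagate as well.\<close>

lemma triangle_propagates:
  assumes A: "A \<in> E // colour_equiv E" and B: "B \<in> E // colour_equiv E"
    and C: "C \<in> E // colour_equiv E" and "A \<noteq> B" "A \<noteq> C"
    and bc: "{b, c} \<in> A" and ca: "{c, a} \<in> B" and ab: "{a, b} \<in> C"
    and pq: "{p, q} \<in> A"
  shows "{a, p} \<in> C \<and> {a, q} \<in> B \<or> {a, p} \<in> B \<and> {a, q} \<in> C"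
proof -
  \<comment> \<open>Since \<open>{a, y}\<close> and \<open>{y, z}\<close> are in different classes,
    \<open>{a, z}\<close> is an edge; since \<open>{x, z}\<close> is missing, it inherits the class
    of \<open>{a, x}\<close>.\<close>
  have spread: "{a, z} \<in> K"
    if "K \<in> E // colour_equiv E" "L \<in> E // colour_equiv E" "A \<noteq> L"
      "{a, x} \<in> K" "{a, y} \<in> L" "{y, z} \<in> A" "{x, z} \<notin> E" for K L x y z
  proof -
    have "{a, z} \<in> E"
      using class_triangle[of L E A a y z] that A by blast
    then show ?thesis
      using class_forced[of K E x a z] that by (simp add: insert_commute)
  qed
  \<comment> \<open>An edge has no preferred order of endpoints, so the induction predicate covers
    every way of writing it as a pair.\<close>
  have "\<forall>p q. {p, q} = {p', q'} \<longrightarrow>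
      {a, p} \<in> C \<and> {a, q} \<in> B \<or> {a, p} \<in> B \<and> {a, q} \<in> C" if "{p', q'} \<in> A" for p' q'
    using A bc that
  proof (induction rule: class_induct)
    case base
    then show ?case
      using ca ab by (auto simp: doubleton_eq_iff insert_commute)
  next
    case (step x y z)
    have "{a, x} \<in> C \<and> {a, y} \<in> B \<or> {a, x} \<in> B \<and> {a, y} \<in> C"
      using step.IH by blast
    then have "{a, z} \<in> C \<and> {a, y} \<in> B \<or> {a, z} \<in> B \<and> {a, y} \<in> C"
      using spread[of C B x y z] spread[of B C x y z] B C assms(4,5) step.hyps by blast
    then show ?case
      by (auto simp: doubleton_eq_iff)
  qed
  then show ?thesis
    using pq by blast
qed

text \<open>Propagating the triangle to an edge of \<open>A\<close> through \<open>a\<close> would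
  produce the loop \<open>{a, a}\<close>.\<close>

lemma apex_notin_class:
  assumes "graph V E"
    and "A \<in> E // colour_equiv E" "B \<in> E // colour_equiv E" "C \<in> E // colour_equiv E"
    and "A \<noteq> B" "A \<noteq> C"
    and "{b, c} \<in> A" "{c, a} \<in> B" "{a, b} \<in> C"
  shows "a \<notin> \<Union>A"
proof
  assume "a \<in> \<Union>A"
  then obtain e where e: "e \<in> A" "a \<in> e"
    by blast
  then have "e \<in> E"
    using assms(2) class_subset by blast
  then obtain d where "e = {a, d}"
    using edge_obtain[OF assms(1)] e by metis
  then have "{a, a} \<in> B \<or> {a, a} \<in> C"
    using triangle_propagates[OF assms(2-9), of a d] e by blast
  then show False
    using graph_no_loop[OF assms(1)] assms(3,4) class_subset by blast
qed

section \<open>Triangles with edges in three classes\<close>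

definition rainbow :: "'a set set \<Rightarrow> 'a \<Rightarrow> 'a \<Rightarrow> 'a \<Rightarrow> bool" where
  "rainbow E x y z \<longleftrightarrow>
     (\<exists>A B C. A \<in> E // colour_equiv E \<and> B \<in> E // colour_equiv E \<and> C \<in> E // colour_equiv E \<and>
        A \<noteq> B \<and> A \<noteq> C \<and> B \<noteq> C \<and> {y, z} \<in> A \<and> {z, x} \<in> B \<and> {x, y} \<in> C)"

lemma card_3_cases:
  assumes "card Q = 3" "A \<in> Q" "B \<in> Q" "C \<in> Q" "A \<noteq> B" "A \<noteq> C" "B \<noteq> C"
  shows "Q = {A, B, C}"
proof -
  have "card {A, B, C} = card Q"
    using assms by simp
  moreover have "finite Q"
    using assms(1) card.infinite by fastforce
  ultimately show ?thesis
    using card_subset_eq[of Q "{A, B, C}"] assms(2-4) by auto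
qed

text \<open>With only three classes, \<open>{x, y}\<close> shares its class with one side of the
  given triangle; the vertex opposite that side serves as \<open>z\<close>, by propagation.\<close>

lemma rainbow_extends_edge:
  assumes "card (E // colour_equiv E) = 3" and "rainbow E a b c" and "{x, y} \<in> E"
  obtains z where "rainbow E x y z"
proof -
  obtain A B C where Q: "A \<in> E // colour_equiv E" "B \<in> E // colour_equiv E" "C \<in> E // colour_equiv E"
    and ne: "A \<noteq> B" "A \<noteq> C" "B \<noteq> C" and abc: "{b, c} \<in> A" "{c, a} \<in> B" "{a, b} \<in> C"
    using assms(2) unfolding rainbow_def by blast
  \<comment> \<open>Treats one side of the triangle; the three cyclic rotations cover all
    classes.\<close>
  have rot: "thesis" if "K \<in> E // colour_equiv E" "L \<in> E // colour_equiv E" "M \<in> E // colour_equiv E"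
    and "K \<noteq> L" "K \<noteq> M" "L \<noteq> M" and "{v, w} \<in> K" "{w, u} \<in> L" "{u, v} \<in> M" "{x, y} \<in> K"
    for K L M u v w
  proof -
    have "{u, x} \<in> M \<and> {u, y} \<in> L \<or> {u, x} \<in> L \<and> {u, y} \<in> M"
      using triangle_propagates[of K E L M v w u x y] that by blast
    then have "rainbow E x y u"
    proof
      assume "{u, x} \<in> M \<and> {u, y} \<in> L"
      then show ?thesis
        using that(1-6,10) unfolding rainbow_def
        by (intro exI[of _ L] exI[of _ M] exI[of _ K]) (simp add: insert_commute)
    next
      assume "{u, x} \<in> L \<and> {u, y} \<in> M"
      then show ?thesis
        using that(1-6,10) unfolding rainbow_def
        by (intro exI[of _ M] exI[of _ L] exI[of _ K]) (simp add: insert_commute)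
    qed
    then show thesis
      by (rule \<open>\<And>z. rainbow E x y z \<Longrightarrow> thesis\<close>)
  qed
  have "{x, y} \<in> A \<or> {x, y} \<in> B \<or> {x, y} \<in> C"
    using edge_in_class[OF assms(3)] card_3_cases[OF assms(1) Q ne] by blast
  then show thesis
    using rot[OF Q ne abc] rot[OF Q(2,3,1) ne(3) ne(1)[symmetric] ne(2)[symmetric] abc(2,3,1)]
      rot[OF Q(3,1,2) ne(2)[symmetric] ne(3)[symmetric] ne(1) abc(3,1,2)] by blast
qed

text \<open>The vertex \<open>x\<close> lies on the sides in \<open>B\<close> and \<open>C\<close>
  and, as an apex, on no edge of \<open>A\<close>; there is no fourth class.\<close>

lemma rainbow_missed_class:
  assumes "graph V E" and "card (E // colour_equiv E) = 3" and "rainbow E x y z"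
    and "K \<in> E // colour_equiv E"
  shows "x \<notin> \<Union>K \<longleftrightarrow> {y, z} \<in> K"
proof -
  obtain A B C where Q: "A \<in> E // colour_equiv E" "B \<in> E // colour_equiv E" "C \<in> E // colour_equiv E"
    and ne: "A \<noteq> B" "A \<noteq> C" "B \<noteq> C" and abc: "{y, z} \<in> A" "{z, x} \<in> B" "{x, y} \<in> C"
    using assms(3) unfolding rainbow_def by blast
  have "x \<notin> \<Union>A"
    using apex_notin_class[OF assms(1) Q ne(1,2) abc] .
  moreover have "x \<in> \<Union>B" "x \<in> \<Union>C"
    using abc by blast+
  moreover have "K = A \<or> K = B \<or> K = C"
    using card_3_cases[OF assms(2) Q ne] assms(4) by blast
  moreover have "{y, z} \<notin> B" "{y, z} \<notin> C"
    using class_eqI Q ne abc by metis+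
  ultimately show ?thesis
    using abc(1) by blast
qed

lemma connected_graph_vertex_edge:
  assumes "connected_graph V E" and "E \<noteq> {}" and "x \<in> V"
  obtains y where "{x, y} \<in> E"
proof -
  have G: "graph V E"
    using assms(1) by (simp add: connected_graph_def)
  obtain e u where "e \<in> E" "u \<in> e"
    using assms(2) G by (force simp: graph_def nsets_def)
  then obtain v where uv: "{u, v} \<in> E" "u \<in> V"
    using edge_obtain[OF G] by metis
  then have "(\<lambda>u v. {u, v} \<in> E)\<^sup>*\<^sup>* x u"
    using assms(1,3) by (simp add: connected_graph_def)
  then show thesis
    using uv that by (cases rule: converse_rtranclpE) auto
qed

section \<open>The tripartition by missed classes\<close>

lemma complete_tripartite_if_rainbow:
  assumes conn: "connected_graph V E" and card3: "card (E // colour_equiv E) = 3"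
    and abc: "rainbow E a b c"
  shows "complete_tripartite V E"
proof -
  let ?Q = "E // colour_equiv E"
  define part where "part K = V - \<Union>K" for K
  have G: "graph V E"
    using conn by (simp add: connected_graph_def)
  have missed: "x \<in> part K \<longleftrightarrow> {y, z} \<in> K" if "rainbow E x y z" "x \<in> V" "K \<in> ?Q" for x y z K
    using rainbow_missed_class[OF G card3 that(1,3)] that(2) by (simp add: part_def)
  have "E \<noteq> {}"
    using card3 by auto
  then have ex: "\<exists>y z. {x, y} \<in> E \<and> rainbow E x y z" if "x \<in> V" for x
    using connected_graph_vertex_edge[OF conn] rainbow_extends_edge[OF card3 abc] that by metis
  have unique: "K = L" if "x \<in> part K" "x \<in> part L" "K \<in> ?Q" "L \<in> ?Q" for x K L
  proof -
    have "x \<in> V"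
      using that(1) by (simp add: part_def)
    then show ?thesis
      using ex missed that class_eqI by metis
  qed
  have cover: "\<exists>K\<in>?Q. x \<in> part K" if "x \<in> V" for x
  proof -
    obtain y z where "rainbow E x y z"
      using ex \<open>x \<in> V\<close> by blast
    moreover from this obtain K where "K \<in> ?Q" "{y, z} \<in> K"
      unfolding rainbow_def by blast
    ultimately show ?thesis
      using missed that by blast
  qed
  have nonempty: "part K \<noteq> {}" if K: "K \<in> ?Q" for K
  proof -
    obtain e where e: "e \<in> K" "e \<in> E"
      using K in_quotient_imp_non_empty[OF equiv_colour_equiv] class_subset by blast
    then obtain u where "u \<in> e"
      using G by (force simp: graph_def nsets_def)
    then obtain v where uv: "e = {u, v}"
      using edge_obtain[OF G e(2)] by metis
    then obtain w where w: "rainbow E u v w"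
      using rainbow_extends_edge[OF card3 abc] e by metis
    \<comment> \<open>The new vertex \<open>w\<close> is opposite an edge of \<open>K\<close>, hence
      it misses \<open>K\<close>.\<close>
    then have r: "rainbow E w u v"
      unfolding rainbow_def by blast
    then have "{w, u} \<in> E"
      unfolding rainbow_def using class_subset by blast
    then have "w \<in> V"
      using edge_subset_vertices[OF G] by blast
    then show ?thesis
      using missed[OF r _ K] e uv by blast
  qed
  have inj: "inj_on part ?Q"
    using nonempty unique by (metis all_not_in_conv inj_onI)
  have disj: "X \<inter> Y = {}" if "X \<in> part ` ?Q" "Y \<in> part ` ?Q" "X \<noteq> Y" for X Y
    using that unique by blast
  \<comment> \<open>In a rainbow triangle on \<open>x\<close>, \<open>y\<close>, \<open>z\<close>
    the class missed by \<open>x\<close> contains \<open>{y, z}\<close>, so \<open>y\<close> does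
    not miss it.\<close>
  have separated: "\<exists>X\<in>part ` ?Q. \<exists>Y\<in>part ` ?Q. X \<noteq> Y \<and> x \<in> X \<and> y \<in> Y" if xy: "{x, y} \<in> E" for x y
  proof -
    have V: "x \<in> V" "y \<in> V"
      using edge_subset_vertices[OF G xy] by blast+
    obtain K L where K: "K \<in> ?Q" "x \<in> part K" and L: "L \<in> ?Q" "y \<in> part L"
      using cover V by blast
    obtain z where z: "rainbow E x y z"
      using rainbow_extends_edge[OF card3 abc xy] .
    then have "{y, z} \<in> K"
      using missed V K by blast
    then have "y \<notin> part K"
      by (auto simp: part_def)
    then show ?thesis
      using K L by blast
  qed
  \<comment> \<open>The side opposite \<open>x\<close> in a rainbow triangle is in \<open>K\<close>,
    and \<open>y\<close> lies on some edge of \<open>K\<close>; propagation to that edge joins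
    \<open>x\<close> to \<open>y\<close>.\<close>
  have joined: "{x, y} \<in> E" if K: "K \<in> ?Q" "x \<in> part K" and L: "L \<in> ?Q" "y \<in> part L"
    and ne: "part K \<noteq> part L" for x y K L
  proof -
    have V: "x \<in> V" "y \<in> V"
      using K L by (auto simp: part_def)
    obtain u w where r: "rainbow E x u w"
      using ex V by blast
    then obtain A B C where Q: "A \<in> ?Q" "B \<in> ?Q" "C \<in> ?Q" "A \<noteq> B" "A \<noteq> C"
      and t: "{u, w} \<in> A" "{w, x} \<in> B" "{x, u} \<in> C"
      unfolding rainbow_def by blast
    have "A = K"
      using missed[OF r V(1) Q(1)] t(1) unique K Q(1) by blast
    have "y \<notin> part K"
      using unique K L ne by blast
    then obtain e where e: "e \<in> K" "y \<in> e"
      using V by (auto simp: part_def)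
    then have "e \<in> E"
      using K(1) class_subset by blast
    then obtain v where "e = {y, v}"
      using edge_obtain[OF G] e by metis
    then have "{x, y} \<in> B \<union> C"
      using triangle_propagates[OF Q t, of y v] e \<open>A = K\<close> by blast
    then show ?thesis
      using Q class_subset by blast
  qed
  have "partition_on V (part ` ?Q)"
  proof (rule partition_onI)
    show "\<Union> (part ` ?Q) = V"
      using cover part_def by blast
    show "disjnt p q" if "p \<in> part ` ?Q" "q \<in> part ` ?Q" "p \<noteq> q" for p q
      using disj[OF that] by (simp add: disjnt_def)
    show "{} \<notin> part ` ?Q"
      using nonempty by blast
  qed
  moreover have "card (part ` ?Q) = 3"
    using card_image[OF inj] card3 by simp
  moreover have "E = {{x, y} | x y. \<exists>X\<in>part ` ?Q. \<exists>Y\<in>part ` ?Q. X \<noteq> Y \<and> x \<in> X \<and> y \<in> Y}"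
    (is "E = ?R")
  proof (intro subset_antisym subsetI)
    fix e assume "e \<in> E"
    then have "card e = 2"
      using G by (auto simp: graph_def nsets_def)
    then obtain x y where "e = {x, y}"
      by (auto simp: card_2_iff)
    then show "e \<in> ?R"
      using separated[of x y] \<open>e \<in> E\<close> unfolding mem_Collect_eq
      by (intro exI[of _ x] exI[of _ y]) simp
  next
    fix e assume "e \<in> ?R"
    then obtain x y X Y where e: "e = {x, y}" and "X \<in> part ` ?Q" "Y \<in> part ` ?Q"
      and ne: "X \<noteq> Y" "x \<in> X" "y \<in> Y"
      unfolding mem_Collect_eq by (elim exE conjE bexE)
    then obtain K L where "K \<in> ?Q" "X = part K" "L \<in> ?Q" "Y = part L"
      by (elim imageE)
    then show "e \<in> E"
      using joined[of K x L y] e ne by simp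
  qed
  ultimately show ?thesis
    unfolding complete_tripartite_def by (intro exI[of _ "part ` ?Q"] conjI)
qed

section \<open>Two overlapping classes yield a rainbow triangle\<close>

text \<open>Consecutive edges of a forcing chain share a vertex, so if no edge of \<open>A\<close>
  crossed the boundary of \<open>U\<close>, lying inside \<open>U\<close> would spread to all of
  \<open>A\<close>.\<close>

lemma class_edge_leaving:
  assumes G: "graph V E" and A: "A \<in> E // colour_equiv E"
    and "\<Union>A \<inter> U \<noteq> {}" and "\<Union>A - U \<noteq> {}"
  obtains x v where "{x, v} \<in> A" "x \<notin> U" "v \<in> U"
proof (rule ccontr)
  assume "\<not> thesis"
  then have closed: "x \<in> U" if "{x, v} \<in> A" "v \<in> U" for x v
    using that \<open>\<And>x v. {x, v} \<in> A \<Longrightarrow> x \<notin> U \<Longrightarrow> v \<in> U \<Longrightarrow> thesis\<close> by blast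
  obtain e v where e: "e \<in> A" "v \<in> e" "v \<in> U"
    using assms(3) by blast
  then have "e \<in> E"
    using A class_subset by blast
  then obtain w where w: "e = {v, w}"
    using edge_obtain[OF G] e by metis
  have "f \<subseteq> U" if "f \<in> A" for f
    using A e(1) that
  proof (induction rule: class_induct)
    case base
    then show ?case
      using w e closed[of w v] by (simp add: insert_commute)
  next
    case (step x y z)
    then show ?case
      using closed[of z y] by (simp add: insert_commute)
  qed
  then show False
    using assms(4) by blast
qed

theorem theorem27:
  fixes V :: "'a set" and E :: "'a set set" and S\<^sub>e S\<^sub>f :: "'a set set"
  assumes "connected_graph V E"
    and "card (E // colour_equiv E) = 3"
    and "S\<^sub>e \<in> E // colour_equiv E"
    and "S\<^sub>f \<in> E // colour_equiv E"
    and "S\<^sub>e \<noteq> S\<^sub>f"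
    and "endpoints S\<^sub>e - endpoints S\<^sub>f \<noteq> {}"
    and "endpoints S\<^sub>f - endpoints S\<^sub>e \<noteq> {}"
    and "endpoints S\<^sub>e \<inter> endpoints S\<^sub>f \<noteq> {}"
  shows "complete_tripartite V E"
proof -
  have G: "graph V E"
    using assms(1) by (simp add: connected_graph_def)
  obtain x v where xv: "{x, v} \<in> S\<^sub>e" "x \<notin> \<Union>S\<^sub>f" "v \<in> \<Union>S\<^sub>f"
    using class_edge_leaving[OF G assms(3), of "\<Union>S\<^sub>f"] assms(6,8) unfolding endpoints_def by blast
  then obtain g where g: "g \<in> S\<^sub>f" "v \<in> g" "g \<in> E"
    using assms(4) class_subset by blast
  then obtain b where vb: "{v, b} \<in> S\<^sub>f"
    using edge_obtain[OF G] by metis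
  obtain y h where y: "y \<in> h" "h \<in> S\<^sub>f" "y \<notin> \<Union>S\<^sub>e" "h \<in> E"
    using assms(4,7) class_subset unfolding endpoints_def by blast
  then obtain w where yw: "{y, w} \<in> S\<^sub>f"
    using edge_obtain[OF G] by metis
  have "{b, x} \<in> E"
    using class_triangle[OF assms(3,4,5) xv(1) vb] by (simp add: insert_commute)
  then obtain C where C: "C \<in> E // colour_equiv E" "{b, x} \<in> C"
    by (rule edge_in_class)
  have "C \<noteq> S\<^sub>f"
    using C xv(2) by blast
  have "C \<noteq> S\<^sub>e"
  proof
    assume "C = S\<^sub>e"
    then have "{x, y} \<in> S\<^sub>e"
      \<comment> \<open>Propagation with apex \<open>x\<close> and both other classes equal to
        \<open>S\<^sub>e\<close>, so the two alternatives coincide.\<close>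
      using triangle_propagates[of S\<^sub>f E S\<^sub>e S\<^sub>e v b x y w] assms(3-5) vb C xv(1) yw by blast
    then show False
      using y(3) by blast
  qed
  then have "rainbow E x v b"
    using assms(3-5) C \<open>C \<noteq> S\<^sub>f\<close> vb xv(1) unfolding rainbow_def
    by (intro exI[of _ S\<^sub>f] exI[of _ C] exI[of _ S\<^sub>e]) simp
  then show ?thesis
    by (rule complete_tripartite_if_rainbow[OF assms(1,2)])
qed

end
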